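(* Let $t_0>0$, $\alpha>0$, $\delta>0$, $\sigma\ge0$, $\mu>0$, $r\in(0,1)$, $\tau\in(0,r+1)$ with $\delta\tau\le1$, and $\beta(t)=\mu t^{\frac1\delta-\tau}$. Let $\epsilon:[t_0,+\infty)\to\mathcal H_1$ satisfy $\int_{t_0}^{+\infty}t^{\tau/2}\|\epsilon(t)\|\,dt<+\infty$. Let $(x(t),\lambda(t))$ be a global solution on $[t_0,+\infty)$ of $$\begin{cases}\ddot x(t)+\frac{\alpha}{t^r}\dot x(t)=-\beta(t)\big(\nabla f(x(t))+A^T(\lambda(t)+\delta t\dot\lambda(t))+\sigma A^T(Ax(t)-b)\big)+\epsilon(t),\\ \ddot\lambda(t)+\frac{\alpha}{t^r}\dot\lambda(t)=\beta(t)\big(A(x(t)+\delta t\dot x(t))-b\big),\end{cases}$$ and let $(x^*,\lambda^* )\in\Omega$. Then $$|f(x(t))-f(x^* )|=\mathcal O\Big(\frac1{t^{1/\delta}}\Big),\qquad \|Ax(t)-b\|=\mathcal O\Big(\frac1{t^{1/\delta}}\Big).$$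
   Context: $\mathcal H_1,\mathcal H_2$ are real Hilbert spaces, $A:\mathcal H_1\to\mathcal H_2$ is a continuous linear operator with adjoint $A^T$, $b\in\mathcal H_2$, and $f:\mathcal H_1\to\mathbb R$ is convex and continuously differentiable. $\Omega\subset\mathcal H_1\times\mathcal H_2$ is the set of saddle points of the Lagrangian $\mathcal L(x,\lambda)=f(x)+\langle\lambda,Ax-b\rangle$, equivalently the set of pairs $(x^*,\lambda^* )$ with $\nabla f(x^* )=-A^T\lambda^*$ and $Ax^*=b$; it is assumed nonempty. A global solution of the system is a pair $(x,\lambda)$ with $x\in\mathcal C^2([t_0,+\infty),\mathcal H_1)$, $\lambda\in\mathcal C^2([t_0,+\infty),\mathcal H_2)$, such that $(x,\lambda)$ and $(\dot x,\dot\lambda)$ are locally absolutely continuous and the system holds for almost every $t\ge t_0$. All $\mathcal O(\cdot)$ are as $t\to+\infty$. *)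

theory Defs
  imports "HOL-Analysis.Analysis" "HOL-Library.Landau_Symbols"
begin

definition lagrangian ::
  "('a::real_inner \<Rightarrow> real) \<Rightarrow> ('a \<Rightarrow> 'b::real_inner) \<Rightarrow> 'b \<Rightarrow> 'a \<Rightarrow> 'b \<Rightarrow> real" where
  "lagrangian f A b x l = f x + l \<bullet> (A x - b)"

definition saddle_points ::
  "('a::real_inner \<Rightarrow> real) \<Rightarrow> ('a \<Rightarrow> 'b::real_inner) \<Rightarrow> 'b \<Rightarrow> ('a \<times> 'b) set" where
  "saddle_points f A b = {(xs, ls). \<forall>x l.
     lagrangian f A b xs l \<le> lagrangian f A b xs ls \<and>
     lagrangian f A b xs ls \<le> lagrangian f A b x ls}"

(* Trajectories on [t0, \<infinity>) are represented by total functions on the reals whose values before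
   t0 are irrelevant: the derivative is taken within {t0..}, hence one-sided at t0. *)
definition ray_deriv :: "real \<Rightarrow> (real \<Rightarrow> 'a::real_normed_vector) \<Rightarrow> real \<Rightarrow> 'a" where
  "ray_deriv t0 x t = vector_derivative x (at t within {t0..})"

definition C2_on_ray :: "real \<Rightarrow> (real \<Rightarrow> 'a::real_normed_vector) \<Rightarrow> bool" where
  "C2_on_ray t0 x \<longleftrightarrow>
     (\<forall>t\<ge>t0. (x has_vector_derivative ray_deriv t0 x t) (at t within {t0..})) \<and>
     (\<forall>t\<ge>t0. (ray_deriv t0 x has_vector_derivative ray_deriv t0 (ray_deriv t0 x) t)
               (at t within {t0..})) \<and>
     continuous_on {t0..} (ray_deriv t0 (ray_deriv t0 x))"

definition absolutely_continuous_on :: "real set \<Rightarrow> (real \<Rightarrow> 'a::real_normed_vector) \<Rightarrow> bool" where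
  "absolutely_continuous_on S f \<longleftrightarrow>
     (\<forall>e>0. \<exists>d>0. \<forall>(n::nat) u v.
        (\<forall>i<n. u i \<le> v i \<and> {u i..v i} \<subseteq> S) \<and>
        disjoint_family_on (\<lambda>i. {u i<..<v i}) {..<n} \<and>
        (\<Sum>i<n. v i - u i) < d
        \<longrightarrow> (\<Sum>i<n. norm (f (v i) - f (u i))) < e)"

definition locally_absolutely_continuous_on_ray ::
  "real \<Rightarrow> (real \<Rightarrow> 'a::real_normed_vector) \<Rightarrow> bool" where
  "locally_absolutely_continuous_on_ray t0 f \<longleftrightarrow>
     (\<forall>T\<ge>t0. absolutely_continuous_on {t0..T} f)"

end

theory Submission
  imports Defs
begin

text \<open>Write \<open>z = (x - xs, l - ls)\<close>, \<open>v = z'\<close> and let \<open>\<phi> = f x - f xs + ls \<bullet> q + \<sigma>/2 \<parallel>q\<parallel>\<^sup>2 \<ge> 0\<close> with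
  \<open>q = A x - b\<close>. Because of the extrapolated arguments \<open>l + \<delta> t l'\<close> and \<open>x + \<delta> t x'\<close>, pairing the
  right-hand side of the system with \<open>z + \<delta> t v\<close> cancels the skew terms and leaves at least
  \<open>\<phi> + \<delta> t \<phi>'\<close>. Hence, with \<open>V = t\<^bsup>\<tau>/2-1\<^esup> (z + \<delta> t v)\<close>, the energy
  \<open>E = \<mu> \<delta>\<^sup>2 t\<^bsup>1/\<delta>\<^esup> \<phi> + \<parallel>V\<parallel>\<^sup>2/2 + h \<parallel>z\<parallel>\<^sup>2/2\<close>, where \<open>h\<close> is chosen to cancel the term \<open>z \<bullet> v\<close>,
  satisfies \<open>E' \<le> \<delta> t\<^bsup>\<tau>/2\<^esup> \<parallel>\<epsilon>\<parallel> \<parallel>V\<parallel>\<close> for large \<open>t\<close>, the leading coefficients having the right sign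
  because \<open>r < 1\<close> and \<open>\<tau> < r + 1\<close>. So \<open>E\<close> is bounded and \<open>\<phi> = O(t\<^bsup>-1/\<delta>\<^esup>)\<close>.

  For \<open>\<sigma> = 0\<close> this does not yet control \<open>q\<close>. But the second equation says
  \<open>\<mu> \<delta> (t\<^bsup>1/\<delta>\<^esup> q)' = t\<^bsup>\<tau>-1\<^esup> (l'' + \<alpha> t\<^bsup>-r\<^esup> l')\<close>; integrating by parts and inserting the bounds on
  \<open>z\<close> and \<open>v\<close> coming from \<open>E\<close> shows that \<open>t\<^bsup>1/\<delta>\<^esup> q\<close> is bounded, and then so is
  \<open>t\<^bsup>1/\<delta>\<^esup> (f x - f xs)\<close>.\<close>

section \<open>Riesz representation and adjoints in Hilbert space\<close>

lemma parallelogram_midpoint: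
  fixes u v :: "'a::real_inner"
  shows "(norm (u - v))\<^sup>2 = 2 * (norm u)\<^sup>2 + 2 * (norm v)\<^sup>2 - 4 * (norm ((1/2) *\<^sub>R (u + v)))\<^sup>2"
  by (simp add: power2_norm_eq_inner inner_simps inner_commute algebra_simps)

text \<open>The representing vector minimises \<open>\<parallel>u\<parallel>\<^sup>2 - 2 \<phi>(u)\<close>; by the parallelogram identity every
  minimising sequence is Cauchy.\<close>

lemma riesz_representation:
  fixes \<phi> :: "'a::{real_inner, complete_space} \<Rightarrow> real"
  assumes "bounded_linear \<phi>"
  obtains w where "\<And>u. \<phi> u = u \<bullet> w"
proof -
  interpret bounded_linear \<phi> by fact
  define J where "J u = (norm u)\<^sup>2 - 2 * \<phi> u" for u
  obtain K where K: "\<And>u. norm (\<phi> u) \<le> norm u * K"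
    using bounded by blast
  have J_ge: "J u \<ge> - K\<^sup>2" for u
  proof -
    have "\<phi> u \<le> norm u * K" using K[of u] by simp
    moreover have "(norm u - K)\<^sup>2 \<ge> 0" by simp
    ultimately show ?thesis by (simp add: J_def power2_eq_square algebra_simps)
  qed
  then have bdd: "bdd_below (range J)" by (meson bdd_belowI2)
  define m where "m = Inf (range J)"
  have m_le: "m \<le> J u" for u unfolding m_def by (rule cInf_lower[OF _ bdd]) simp
  have "\<exists>u. J u < m + e" if "e > 0" for e
    using cInf_lessD[of "range J" "m + e"] that by (auto simp: m_def)
  then have "\<exists>u. J u < m + 1 / real (Suc n)" for n by simp
  then obtain y where y: "\<And>n. J (y n) < m + 1 / real (Suc n)" by metis
  have parallelogram: "(norm (u - v))\<^sup>2 = 2 * J u + 2 * J v - 4 * J ((1/2) *\<^sub>R (u + v))" for u v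
    unfolding J_def parallelogram_midpoint by (simp add: scaleR add field_simps)
  \<comment> \<open>Both values of \<open>J\<close> exceed \<open>m\<close> by less than e^2/4 and
    each counts twice, while the midpoint value is at least \<open>m\<close>; the terms in
    \<open>m\<close> cancel and e^2 is left.\<close>
  have close: "(norm (y n - y k))\<^sup>2 < e\<^sup>2"
    if "e > 0" "real (Suc n) > 4 / e\<^sup>2" "real (Suc k) > 4 / e\<^sup>2" for n k e
  proof -
    have "1 / real (Suc n) < e\<^sup>2 / 4" "1 / real (Suc k) < e\<^sup>2 / 4"
      using that by (auto simp: field_simps)
    then show ?thesis
      using parallelogram[of "y n" "y k"] y[of n] y[of k] m_le[of "(1/2) *\<^sub>R (y n + y k)"]
      by linarith
  qed
  have "Cauchy y"
  proof (rule metric_CauchyI)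
    fix e :: real assume e: "e > 0"
    obtain M :: nat where M: "real M > 4 / e\<^sup>2" using reals_Archimedean2 by blast
    have "dist (y n) (y k) < e" if "n \<ge> M" "k \<ge> M" for n k
      unfolding dist_norm
    proof (rule power_less_imp_less_base[of _ 2])
      show "(norm (y n - y k))\<^sup>2 < e\<^sup>2" by (rule close) (use e M that in auto)
    qed (use e in simp)
    then show "\<exists>M. \<forall>n\<ge>M. \<forall>k\<ge>M. dist (y n) (y k) < e" by blast
  qed
  then obtain w where w: "y \<longlonglongrightarrow> w" using Cauchy_convergent convergent_def by blast
  have "(\<lambda>n. J (y n)) \<longlonglongrightarrow> J w" unfolding J_def by (intro tendsto_intros tendsto w)
  moreover have "(\<lambda>n. m + 1 / real (Suc n)) \<longlonglongrightarrow> m + 0"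
    by (intro tendsto_intros LIMSEQ_Suc lim_1_over_n)
  ultimately have "J w \<le> m + 0"
    by (rule LIMSEQ_le) (use y less_imp_le in blast)
  then have min: "J w \<le> J u" for u using m_le[of u] by simp
  have "\<phi> u = u \<bullet> w" for u
  proof (rule ccontr)
    define d where "d = \<phi> u - u \<bullet> w"
    assume "\<phi> u \<noteq> u \<bullet> w"
    then have d: "d \<noteq> 0" by (simp add: d_def)
    \<comment> \<open>Minimality of \<open>w\<close> along the line in direction \<open>u\<close>:
      the left side is linear in \<open>s\<close>, the right side quadratic. Taking s = d / (u . u),
      or s = d when u . u = 0, contradicts d \<noteq> 0.\<close>
    have quad: "2 * s * d \<le> s\<^sup>2 * (u \<bullet> u)" for s
      using min[of "w + s *\<^sub>R u"]
      by (simp only: J_def d_def add scaleR power2_norm_eq_inner)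
        (simp add: inner_simps inner_commute power2_eq_square algebra_simps)
    show False
    proof (cases "u \<bullet> u = 0")
      case True
      with quad[of d] d show False by (simp add: power2_eq_square[symmetric] mult.assoc)
    next
      case False
      then have "u \<bullet> u > 0" using inner_ge_zero[of u] by linarith
      moreover from this have "2 * d\<^sup>2 / (u \<bullet> u) \<le> d\<^sup>2 / (u \<bullet> u)"
        using quad[of "d / (u \<bullet> u)"] by (simp add: power2_eq_square field_simps)
      ultimately show False using d by (simp add: field_simps)
    qed
  qed
  then show thesis by (rule that)
qed

text \<open>\<open>adjoint\<close> is a Hilbert choice among the maps with this property, so one
  such map has to exist. Representing the functional \<open>A u \<bullet> w\<close> of
  \<open>u\<close> for each \<open>w\<close> provides it.\<close>

lemma adjoint_inner:
  fixes A :: "'a::{real_inner, complete_space} \<Rightarrow> 'b::real_inner"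
  assumes "bounded_linear A"
  shows "A u \<bullet> w = u \<bullet> adjoint A w"
proof -
  have "\<exists>v. \<forall>u. A u \<bullet> w = u \<bullet> v" for w
    using riesz_representation[OF bounded_linear_compose[OF bounded_linear_inner_left assms], of w]
    by metis
  then have "\<exists>g. \<forall>u w. A u \<bullet> w = u \<bullet> g w" by metis
  then have "\<forall>u w. A u \<bullet> w = u \<bullet> adjoint A w" unfolding adjoint_def by (rule someI_ex)
  then show ?thesis by blast
qed

lemma bounded_linear_adjoint:
  fixes A :: "'a::{real_inner, complete_space} \<Rightarrow> 'b::real_inner"
  assumes "bounded_linear A"
  shows "bounded_linear (adjoint A)"
proof -
  interpret bounded_linear A by fact
  obtain K where K: "\<And>u. norm (A u) \<le> norm u * K" "K \<ge> 0" using nonneg_bounded by blast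
  have eqI: "p = q" if "\<And>u. u \<bullet> p = u \<bullet> q" for p q :: 'a
    using that[of "p - q"] by (metis inner_diff_right inner_eq_zero_iff right_minus_eq)
  show ?thesis
  proof (rule bounded_linear_intro[of _ K])
    fix v w s
    show "adjoint A (v + w) = adjoint A v + adjoint A w"
      by (rule eqI) (simp add: inner_simps flip: adjoint_inner[OF assms])
    show "adjoint A (s *\<^sub>R v) = s *\<^sub>R adjoint A v"
      by (rule eqI) (simp add: inner_simps flip: adjoint_inner[OF assms])
    \<comment> \<open>Moving the adjoint across once lets the bound \<open>K\<close> of
      \<open>A\<close> serve for its adjoint too, after division by one factor
      \<open>norm (adjoint A v)\<close>.\<close>
    have "(norm (adjoint A v))\<^sup>2 = A (adjoint A v) \<bullet> v"
      by (simp add: adjoint_inner[OF assms] power2_norm_eq_inner)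
    also have "\<dots> \<le> norm (A (adjoint A v)) * norm v" by (rule norm_cauchy_schwarz)
    also have "\<dots> \<le> norm (adjoint A v) * K * norm v" by (intro mult_right_mono K) simp
    finally show "norm (adjoint A v) \<le> norm v * K"
      by (cases "adjoint A v = 0") (auto simp: power2_eq_square mult.commute K)
  qed
qed

text \<open>Restricting \<open>f\<close> to the line from \<open>y\<close> to \<open>u\<close>
  reduces this to the tangent inequality for convex functions of one real variable.\<close>

lemma convex_on_GDERIV_above_tangent:
  fixes f :: "'a::real_inner \<Rightarrow> real"
  assumes convex: "convex_on UNIV f" and grad: "GDERIV f y :> g"
  shows "f u - f y \<ge> g \<bullet> (u - y)"
proof -
  define p where "p s = f (y + s *\<^sub>R (u - y))" for s :: real
  have "convex_on UNIV p"
    unfolding p_def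
  proof (rule convex_onI)
    fix s a c :: real assume s: "0 < s" "s < 1"
    have "y + ((1 - s) *\<^sub>R a + s *\<^sub>R c) *\<^sub>R (u - y)
      = (1 - s) *\<^sub>R (y + a *\<^sub>R (u - y)) + s *\<^sub>R (y + c *\<^sub>R (u - y))"
      by (simp add: algebra_simps)
    then show "f (y + ((1 - s) *\<^sub>R a + s *\<^sub>R c) *\<^sub>R (u - y))
      \<le> (1 - s) * f (y + a *\<^sub>R (u - y)) + s * f (y + c *\<^sub>R (u - y))"
      using convex_onD[OF convex, of s "y + a *\<^sub>R (u - y)" "y + c *\<^sub>R (u - y)"] s by simp
  qed simp
  moreover have "(p has_real_derivative g \<bullet> (u - y)) (at 0)"
  proof -
    have "((\<lambda>s. y + s *\<^sub>R (u - y)) has_derivative (\<lambda>s. s *\<^sub>R (u - y))) (at 0)"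
      by (auto intro!: derivative_eq_intros)
    moreover have "(f has_derivative (\<lambda>h. h \<bullet> g)) (at (y + 0 *\<^sub>R (u - y)))"
      using grad by (simp add: gderiv_def)
    ultimately have "(p has_derivative (\<lambda>s. (s *\<^sub>R (u - y)) \<bullet> g)) (at 0)"
      unfolding p_def by (rule has_derivative_compose)
    then show ?thesis
      by (simp add: has_field_derivative_def inner_commute mult_commute_abs)
  qed
  ultimately have "p 1 - p 0 \<ge> (g \<bullet> (u - y)) * (1 - 0)"
    by (intro convex_on_imp_above_tangent[of UNIV]) auto
  then show ?thesis by (simp add: p_def)
qed

section \<open>Energy estimate for a perturbed damped equation\<close>

text \<open>A Gronwall-type argument: sqrt(2E) is at most 2 sqrt(E + 1), so the derivative of sqrt(E
  + 1) is at most \<open>k\<close>. Adding 1 keeps the square root differentiable where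
  \<open>E\<close> vanishes.\<close>

lemma sqrt_energy_nonincreasing:
  fixes E K :: "real \<Rightarrow> real"
  assumes "T \<le> t" and E_nonneg: "\<And>s. s \<ge> T \<Longrightarrow> E s \<ge> 0"
    and E: "\<And>s. s \<ge> T \<Longrightarrow> (E has_real_derivative E' s) (at s)"
    and K: "\<And>s. s \<ge> T \<Longrightarrow> (K has_real_derivative k s) (at s)"
    and k_nonneg: "\<And>s. s \<ge> T \<Longrightarrow> k s \<ge> 0"
    and bound: "\<And>s. s \<ge> T \<Longrightarrow> E' s \<le> k s * sqrt (2 * E s)"
  shows "sqrt (E t + 1) - K t \<le> sqrt (E T + 1) - K T"
proof (rule DERIV_nonpos_imp_nonincreasing[OF \<open>T \<le> t\<close>])
  fix s assume s: "T \<le> s" "s \<le> t"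
  have pos: "E s + 1 > 0" using E_nonneg[of s] s by simp
  have "((\<lambda>s. sqrt (E s + 1) - K s) has_real_derivative E' s * (inverse (sqrt (E s + 1)) / 2) - k s) (at s)"
    using pos s by (auto intro!: derivative_eq_intros E K)
  moreover have "E' s * (inverse (sqrt (E s + 1)) / 2) - k s \<le> 0"
  proof -
    have "sqrt (2 * E s) \<le> sqrt (4 * (E s + 1))"
      using E_nonneg[of s] s by (intro real_sqrt_le_mono) simp
    also have "\<dots> = 2 * sqrt (E s + 1)" by (simp only: real_sqrt_mult real_sqrt_four)
    finally have "E' s \<le> k s * (2 * sqrt (E s + 1))"
      using bound[of s] k_nonneg[of s] s by (meson mult_left_mono order_trans)
    then show ?thesis using pos by (simp add: field_simps)
  qed
  ultimately show "\<exists>y. ((\<lambda>s. sqrt (E s + 1) - K s) has_real_derivative y) (at s) \<and> y \<le> 0"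
    by blast
qed

text \<open>The primal and dual equations are treated as one equation for \<open>z\<close> in a
  product space. Convexity and the saddle structure enter only through the sign of \<phi> and the
  lower bound on the pairing with \<open>F\<close>.\<close>

lemma energy_bounds:
  fixes z v F e :: "real \<Rightarrow> 'c::real_inner" and \<phi> \<phi>' :: "real \<Rightarrow> real"
  assumes t0: "t0 > 0" and \<alpha>: "\<alpha> > 0" and \<delta>: "\<delta> > 0" and \<mu>: "\<mu> > 0"
    and r: "r < 1" and \<tau>: "\<tau> < r + 1"
    and z: "\<And>t. t > t0 \<Longrightarrow> (z has_vector_derivative v t) (at t)"
    and v: "\<And>t. t > t0 \<Longrightarrow> (v has_vector_derivative
      e t - (\<alpha> / t powr r) *\<^sub>R v t - (\<mu> * t powr (1 / \<delta> - \<tau>)) *\<^sub>R F t) (at t)"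
    and \<phi>: "\<And>t. t > t0 \<Longrightarrow> (\<phi> has_real_derivative \<phi>' t) (at t)"
    and \<phi>_nonneg: "\<And>t. t > t0 \<Longrightarrow> \<phi> t \<ge> 0"
    and F: "\<And>t. t > t0 \<Longrightarrow> F t \<bullet> (z t + (\<delta> * t) *\<^sub>R v t) \<ge> \<phi> t + \<delta> * t * \<phi>' t"
    and e_cont: "continuous_on {t0..} e"
    and e_int: "(\<lambda>t. t powr (\<tau> / 2) * norm (e t)) integrable_on {t0..}"
  obtains T C where "T > t0" "C \<ge> 0"
    "\<And>t. t \<ge> T \<Longrightarrow> t powr (1 / \<delta>) * \<phi> t \<le> C"
    "\<And>t. t \<ge> T \<Longrightarrow> norm (z t) \<le> C * t powr ((1 + r - \<tau>) / 2)"
    "\<And>t. t \<ge> T \<Longrightarrow> norm (v t) \<le> C * t powr (- \<tau> / 2)"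
proof -
  \<comment> \<open>In V . V' the product z . v has coefficient P^2 (\<kappa> - \<alpha> \<delta>
    S), so \<kappa> collects the part without the growing factor \<open>S\<close>, and
    \<open>h\<close> below is the negative of this coefficient.\<close>
  define \<kappa> where "\<kappa> = 1 + \<delta> * \<tau> - \<delta>"
  \<comment> \<open>The three thresholds for \<open>S\<close> make, in this order, the v . v term of
    \<open>E'\<close> nonpositive, \<open>h\<close> at least half its leading term, and the z . z
    term of \<open>E'\<close> nonpositive. They are eventually exceeded because r < 1; the last one
    divides by 1 + r - \<tau> > 0.\<close>
  define M where "M = max (max ((1 + \<delta> * \<tau> / 2) / (\<alpha> * \<delta>)) (2 * \<kappa> / (\<alpha> * \<delta>)))
    ((\<kappa> * (2 - \<tau>) + (\<tau> - 2)) / (\<alpha> * \<delta> * (1 + r - \<tau>)))"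
  define T0 where "T0 = max M 1 powr (1 / (1 - r))"
  have T0: "t powr (1 - r) \<ge> M" if "t \<ge> T0" for t
  proof -
    have "max M 1 = T0 powr (1 - r)" using r by (simp add: T0_def powr_powr)
    also have "\<dots> \<le> t powr (1 - r)" using that r by (intro powr_mono2) (auto simp: T0_def)
    finally show ?thesis by simp
  qed
  define T where "T = max (max T0 1) (t0 + 1)"
  have T: "T > t0" "T \<ge> 1" "T \<ge> T0" by (auto simp: T_def)
  define P where "P t = t powr (\<tau> / 2 - 1)" for t :: real
  define S where "S t = t powr (1 - r)" for t :: real
  have P_pos: "P t > 0" and S_pos: "S t > 0" if "t > 0" for t using that by (auto simp: P_def S_def)
  have S1: "\<alpha> * \<delta> * S t \<ge> 1 + \<delta> * \<tau> / 2"
    and S2: "\<alpha> * \<delta> * S t \<ge> 2 * \<kappa>"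
    and S3: "\<alpha> * \<delta> * (1 + r - \<tau>) * S t \<ge> \<kappa> * (2 - \<tau>) + (\<tau> - 2)" if "t \<ge> T" for t
  proof -
    have "S t \<ge> M" using T0 T that by (auto simp: S_def)
    then have "S t \<ge> (1 + \<delta> * \<tau> / 2) / (\<alpha> * \<delta>)" "S t \<ge> 2 * \<kappa> / (\<alpha> * \<delta>)"
      "S t \<ge> (\<kappa> * (2 - \<tau>) + (\<tau> - 2)) / (\<alpha> * \<delta> * (1 + r - \<tau>))"
      by (auto simp: M_def)
    moreover have "\<alpha> * \<delta> > 0" "\<alpha> * \<delta> * (1 + r - \<tau>) > 0" using \<alpha> \<delta> \<tau> by auto
    ultimately show "\<alpha> * \<delta> * S t \<ge> 1 + \<delta> * \<tau> / 2" "\<alpha> * \<delta> * S t \<ge> 2 * \<kappa>"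
      "\<alpha> * \<delta> * (1 + r - \<tau>) * S t \<ge> \<kappa> * (2 - \<tau>) + (\<tau> - 2)"
      by (simp_all only: pos_divide_le_eq mult.commute[of "S t"])
  qed
  define V where "V t = P t *\<^sub>R z t + (\<delta> * t * P t) *\<^sub>R v t" for t
  define h where "h t = (P t)\<^sup>2 * (\<alpha> * \<delta> * S t - \<kappa>)" for t
  define E where "E t = \<mu> * \<delta>\<^sup>2 * (t powr (1 / \<delta>) * \<phi> t) + (V t \<bullet> V t) / 2 + h t * (z t \<bullet> z t) / 2" for t
  define k where "k t = t powr (\<tau> / 2) * norm (e t)" for t
  define a where "a t = e t - (\<alpha> / t powr r) *\<^sub>R v t - (\<mu> * t powr (1 / \<delta> - \<tau>)) *\<^sub>R F t" for t
  define V' where "V' t = ((\<tau> / 2 - 1) * (P t / t)) *\<^sub>R z t + (P t + \<delta> * \<tau> / 2 * P t) *\<^sub>R v t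
      + (\<delta> * t * P t) *\<^sub>R a t" for t
  define h' where "h' t = (P t)\<^sup>2 / t * (\<alpha> * \<delta> * (\<tau> - 1 - r) * S t - \<kappa> * (\<tau> - 2))" for t
  define E' where "E' t = \<mu> * \<delta> * t powr (1 / \<delta> - 1) * \<phi> t + \<mu> * \<delta>\<^sup>2 * t powr (1 / \<delta>) * \<phi>' t
     + V t \<bullet> V' t + h' t * (z t \<bullet> z t) / 2 + h t * (z t \<bullet> v t)" for t
  have powr_deriv: "((\<lambda>t. t powr p) has_real_derivative p * (t powr p / t)) (at t)"
    if "t > 0" for p t :: real
    using has_real_derivative_powr[OF that, of p] that by (simp add: powr_diff)
  have P_deriv: "(P has_real_derivative (\<tau> / 2 - 1) * (P t / t)) (at t)"
    and S_deriv: "(S has_real_derivative (1 - r) * (S t / t)) (at t)" if "t > 0" for t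
    unfolding P_def S_def by (intro powr_deriv that)+
  have h_deriv: "(h has_real_derivative h' t) (at t)" if "t > 0" for t
    unfolding h_def h'_def using that
    by (auto intro!: derivative_eq_intros P_deriv S_deriv simp: power2_eq_square field_simps)
  have V_deriv: "(V has_vector_derivative V' t) (at t)" if "t > t0" for t
  proof -
    have *: "((\<lambda>t. \<delta> * t * P t) has_real_derivative \<delta> * \<tau> / 2 * P t) (at t)"
      using that t0 by (auto intro!: derivative_eq_intros P_deriv simp: field_simps)
    have "(V has_vector_derivative (P t *\<^sub>R v t + ((\<tau> / 2 - 1) * (P t / t)) *\<^sub>R z t)
       + ((\<delta> * t * P t) *\<^sub>R a t + (\<delta> * \<tau> / 2 * P t) *\<^sub>R v t)) (at t)"
      unfolding V_def using that t0 z[OF that] v[OF that]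
      by (intro has_vector_derivative_add has_vector_derivative_scaleR P_deriv *) (auto simp: a_def)
    then show ?thesis unfolding V'_def by (simp add: algebra_simps)
  qed
  have inner_deriv: "((\<lambda>t. g t \<bullet> g t) has_real_derivative 2 * (g t \<bullet> g' t)) (at t)"
    if "(g has_vector_derivative g' t) (at t)" for g g' :: "real \<Rightarrow> 'c" and t
  proof -
    have "((\<lambda>t. g t \<bullet> g t) has_derivative (\<lambda>s. g t \<bullet> (s *\<^sub>R g' t) + (s *\<^sub>R g' t) \<bullet> g t)) (at t)"
      using that unfolding has_vector_derivative_def by (intro has_derivative_inner)
    moreover have "(\<lambda>s. g t \<bullet> (s *\<^sub>R g' t) + (s *\<^sub>R g' t) \<bullet> g t) = (*) (2 * (g t \<bullet> g' t))"
      by (auto simp: inner_commute)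
    ultimately show ?thesis by (simp add: has_field_derivative_def)
  qed
  have E_deriv: "(E has_real_derivative E' t) (at t)" if "t > t0" for t
  proof -
    have t: "t > 0" using that t0 by simp
    have "((\<lambda>t. t powr (1 / \<delta>)) has_real_derivative 1 / \<delta> * t powr (1 / \<delta> - 1)) (at t)"
      using t by (rule has_real_derivative_powr)
    then show ?thesis
      unfolding E_def E'_def using t \<delta>
      by (auto intro!: derivative_eq_intros \<phi>[OF that] h_deriv[OF t] inner_deriv[of V V', OF V_deriv[OF that]]
          inner_deriv[of z v, OF z[OF that]] simp: power2_eq_square field_simps)
  qed
  have E'_le: "E' t \<le> \<delta> * k t * norm (V t)" if "t \<ge> T" for t
  proof -
    have t: "t > 0" "t > t0" using that T t0 by auto
    \<comment> \<open>Since (t P)^2 = t^\<tau>, all powers of \<open>t\<close> in \<open>E'\<close>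
      become multiples of P^2, \<open>Q\<close> and \<open>S\<close>, and the identity for
      \<open>E'\<close> becomes one of rational expressions.\<close>
    define Q where "Q = t powr (1 / \<delta> - \<tau>)"
    have "(P t)\<^sup>2 = t powr \<tau> / t\<^sup>2"
      unfolding P_def power2_eq_square powr_add[symmetric] using t by (simp add: powr_diff power2_eq_square)
    then have powr_eqs: "t powr (1 / \<delta> - 1) = (P t)\<^sup>2 * t * Q"
      "t powr (1 / \<delta>) = (P t)\<^sup>2 * t\<^sup>2 * Q" "\<alpha> / t powr r = \<alpha> * S t / t"
      using t by (auto simp: S_def Q_def powr_diff power2_eq_square)
    \<comment> \<open>The z . v terms are gone by the choice of \<open>h\<close>. What is left is
      the \<phi> defect bounded by the hypothesis on \<open>F\<close>, the forcing, and two squares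
      whose signs are fixed by \<open>S3\<close> and \<open>S1\<close>.\<close>
    have "E' t = \<mu> * \<delta> * (P t)\<^sup>2 * t * Q * (\<phi> t + \<delta> * t * \<phi>' t - F t \<bullet> (z t + (\<delta> * t) *\<^sub>R v t))
       + \<delta> * t * P t * (e t \<bullet> V t)
       - (P t)\<^sup>2 / t / 2 * (\<alpha> * \<delta> * (1 + r - \<tau>) * S t - (\<kappa> * (2 - \<tau>) + (\<tau> - 2))) * (z t \<bullet> z t)
       - \<delta> * t * (P t)\<^sup>2 * (\<alpha> * \<delta> * S t - (1 + \<delta> * \<tau> / 2)) * (v t \<bullet> v t)"
      unfolding E'_def V'_def V_def a_def h'_def h_def powr_eqs Q_def[symmetric] \<kappa>_def
      using t by (simp add: inner_add_left inner_add_right inner_diff_left inner_diff_right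
        inner_commute power2_eq_square field_simps)
    also have "\<dots> \<le> \<delta> * t * P t * (e t \<bullet> V t)"
    proof -
      have "\<mu> * \<delta> * (P t)\<^sup>2 * t * Q * (\<phi> t + \<delta> * t * \<phi>' t - F t \<bullet> (z t + (\<delta> * t) *\<^sub>R v t)) \<le> 0"
        using F[OF t(2)] \<mu> \<delta> t by (intro mult_nonneg_nonpos) (auto simp: Q_def)
      moreover have "(P t)\<^sup>2 / t / 2 * (\<alpha> * \<delta> * (1 + r - \<tau>) * S t
          - (\<kappa> * (2 - \<tau>) + (\<tau> - 2))) * (z t \<bullet> z t) \<ge> 0"
        using S3[OF that] t by (intro mult_nonneg_nonneg) auto
      moreover have "\<delta> * t * (P t)\<^sup>2 * (\<alpha> * \<delta> * S t - (1 + \<delta> * \<tau> / 2)) * (v t \<bullet> v t) \<ge> 0"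
        using S1[OF that] t \<delta> by (intro mult_nonneg_nonneg) auto
      ultimately show ?thesis by linarith
    qed
    also have "\<dots> \<le> \<delta> * t * P t * (norm (e t) * norm (V t))"
      using t \<delta> P_pos[of t] by (intro mult_left_mono norm_cauchy_schwarz) auto
    also have "\<dots> = \<delta> * k t * norm (V t)"
    proof -
      have "t powr (\<tau> / 2) = t * P t" using t by (simp add: P_def powr_diff)
      then show ?thesis by (simp add: k_def mult_ac)
    qed
    finally show ?thesis .
  qed
  \<comment> \<open>By \<open>S2\<close> half of the leading term absorbs \<kappa>, and P^2 S =
    t^(\<tau> - 1 - r). This weight decays, so a bounded energy limits only the growth of
    \<open>z\<close>.\<close>
  have h_ge: "h t \<ge> \<alpha> * \<delta> / 2 * t powr (\<tau> - 1 - r)" if "t \<ge> T" for t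
  proof -
    have "\<alpha> * \<delta> / 2 * S t \<le> \<alpha> * \<delta> * S t - \<kappa>" using S2[OF that] by simp
    then have "(P t)\<^sup>2 * (\<alpha> * \<delta> / 2 * S t) \<le> h t" unfolding h_def by (rule mult_left_mono) simp
    moreover have "(P t)\<^sup>2 * S t = t powr (\<tau> - 1 - r)"
      unfolding P_def S_def power2_eq_square powr_add[symmetric] by (simp add: algebra_simps)
    ultimately show ?thesis by (simp add: algebra_simps)
  qed
  have parts_nonneg: "\<mu> * \<delta>\<^sup>2 * (t powr (1 / \<delta>) * \<phi> t) \<ge> 0"
    "h t * (z t \<bullet> z t) \<ge> 0" if "t \<ge> T" for t
    using that T \<phi>_nonneg[of t] \<mu> h_ge[OF that] \<alpha> \<delta>
    by (auto intro!: mult_nonneg_nonneg order_trans[OF _ h_ge[OF that]])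
  have E_nonneg: "E t \<ge> 0" and V_le: "norm (V t) \<le> sqrt (2 * E t)" if "t \<ge> T" for t
  proof -
    show "E t \<ge> 0" using parts_nonneg[OF that] by (simp add: E_def)
    have "V t \<bullet> V t \<le> 2 * E t" using parts_nonneg[OF that] by (simp add: E_def)
    then show "norm (V t) \<le> sqrt (2 * E t)" unfolding norm_eq_sqrt_inner by (rule real_sqrt_le_mono)
  qed
  define K where "K t = integral {t0..t} k" for t
  have k_cont: "continuous_on {t0..} k"
    unfolding k_def using t0 by (intro continuous_intros e_cont) auto
  have K_deriv: "(K has_real_derivative k t) (at t)" if "t > t0" for t
  proof -
    have "(K has_real_derivative k t) (at t within {t0..t + 1})"
      unfolding K_def using that
      by (intro integral_has_real_derivative continuous_on_subset[OF k_cont]) auto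
    then show ?thesis using that at_within_Icc_at[of t0 t "t + 1"] by simp
  qed
  have k_nonneg: "k t \<ge> 0" for t by (simp add: k_def)
  \<comment> \<open>Bound for sqrt(E + 1): its value at \<open>T\<close> plus \<delta> times the
    total weighted mass of the perturbation.\<close>
  define B where "B = sqrt (E T + 1) + \<delta> * integral {t0..} k"
  have K_bounds: "0 \<le> K t" "K t \<le> integral {t0..} k" for t
    unfolding K_def
  proof -
    have *: "k integrable_on {t0..}" using e_int by (simp add: k_def[abs_def])
    have **: "k integrable_on {t0..t}"
      by (intro integrable_continuous_real continuous_on_subset[OF k_cont]) auto
    show "0 \<le> integral {t0..t} k" by (intro integral_nonneg ** k_nonneg)
    show "integral {t0..t} k \<le> integral {t0..} k" by (intro integral_subset_le * **) (auto simp: k_nonneg)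
  qed
  have E_le: "E t \<le> B\<^sup>2" if "t \<ge> T" for t
  proof -
    have "sqrt (E t + 1) - \<delta> * K t \<le> sqrt (E T + 1) - \<delta> * K T"
    proof (rule sqrt_energy_nonincreasing[OF that E_nonneg])
      fix s assume s: "s \<ge> T"
      show "(E has_real_derivative E' s) (at s)" using s T by (intro E_deriv) simp
      show "((\<lambda>s. \<delta> * K s) has_real_derivative \<delta> * k s) (at s)"
        using s T by (intro DERIV_cmult K_deriv) simp
      show "\<delta> * k s \<ge> 0" using \<delta> k_nonneg by simp
      show "E' s \<le> \<delta> * k s * sqrt (2 * E s)"
        using E'_le[OF s] V_le[OF s] \<delta> k_nonneg[of s]
        by (meson mult_left_mono mult_nonneg_nonneg less_imp_le order_trans)
    qed auto
    moreover have "\<delta> * K t \<le> \<delta> * integral {t0..} k" "\<delta> * K T \<ge> 0"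
      using \<delta> K_bounds by (auto intro!: mult_left_mono)
    ultimately have "sqrt (E t + 1) \<le> B" by (simp add: B_def)
    then have "E t + 1 \<le> B\<^sup>2" by (rule sqrt_le_D)
    then show ?thesis by simp
  qed
  define C1 where "C1 = sqrt (4 * B\<^sup>2 / (\<alpha> * \<delta>))"
  have z_le: "norm (z t) \<le> C1 * t powr ((1 + r - \<tau>) / 2)" if "t \<ge> T" for t
  proof (rule power2_le_imp_le)
    have t: "t > 0" using that T by simp
    have "\<alpha> * \<delta> / 2 * t powr (\<tau> - 1 - r) * (z t \<bullet> z t) \<le> h t * (z t \<bullet> z t)"
      using h_ge[OF that] by (rule mult_right_mono) simp
    also have "\<dots> \<le> 2 * E t" using parts_nonneg[OF that] by (simp add: E_def)
    also have "\<dots> \<le> 2 * B\<^sup>2" using E_le[OF that] by simp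
    finally have "t powr (\<tau> - 1 - r) * (z t \<bullet> z t) \<le> 4 * B\<^sup>2 / (\<alpha> * \<delta>)"
      using \<alpha> \<delta> by (simp add: field_simps)
    then have "t powr (1 + r - \<tau>) * (t powr (\<tau> - 1 - r) * (z t \<bullet> z t))
        \<le> t powr (1 + r - \<tau>) * (4 * B\<^sup>2 / (\<alpha> * \<delta>))"
      by (rule mult_left_mono) simp
    moreover have "t powr (1 + r - \<tau>) * (t powr (\<tau> - 1 - r) * (z t \<bullet> z t)) = (norm (z t))\<^sup>2"
      using t by (simp add: mult.assoc[symmetric] powr_add[symmetric] power2_norm_eq_inner)
    moreover have "(C1 * t powr ((1 + r - \<tau>) / 2))\<^sup>2 = t powr (1 + r - \<tau>) * (4 * B\<^sup>2 / (\<alpha> * \<delta>))"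
    proof -
      have "C1\<^sup>2 = 4 * B\<^sup>2 / (\<alpha> * \<delta>)" using \<alpha> \<delta> by (simp add: C1_def)
      moreover have "(t powr ((1 + r - \<tau>) / 2))\<^sup>2 = t powr (1 + r - \<tau>)"
        by (simp add: power2_eq_square powr_add[symmetric])
      ultimately show ?thesis by (simp add: power_mult_distrib)
    qed
    ultimately show "(norm (z t))\<^sup>2 \<le> (C1 * t powr ((1 + r - \<tau>) / 2))\<^sup>2" by simp
    show "0 \<le> C1 * t powr ((1 + r - \<tau>) / 2)" using \<alpha> \<delta> by (simp add: C1_def)
  qed
  define C2 where "C2 = (sqrt (2 * B\<^sup>2) + C1) / \<delta>"
  have v_le: "norm (v t) \<le> C2 * t powr (- \<tau> / 2)" if "t \<ge> T" for t
  proof -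
    have t: "t > 0" "t \<ge> 1" using that T by auto
    have d: "\<delta> * t * P t = \<delta> * t powr (\<tau> / 2)" using t by (simp add: P_def powr_diff)
    have "norm (V t) \<le> sqrt (2 * B\<^sup>2)"
      using V_le[OF that] E_le[OF that] by (meson mult_left_mono order_trans real_sqrt_le_mono zero_le_numeral)
    \<comment> \<open>The exponents add up to (r - 1)/2 < 0, so the \<open>z\<close> part of
      \<open>V\<close> is bounded and the bound on \<open>V\<close> passes to
      \<open>v\<close>.\<close>
    moreover have "norm (P t *\<^sub>R z t) \<le> C1"
    proof -
      have "norm (P t *\<^sub>R z t) \<le> P t * (C1 * t powr ((1 + r - \<tau>) / 2))"
        using z_le[OF that] P_pos[OF t(1)] by simp
      also have "\<dots> = C1 * t powr ((r - 1) / 2)"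
        by (simp add: P_def powr_add[symmetric] mult.left_commute diff_divide_distrib add_divide_distrib)
      also have "t powr ((r - 1) / 2) \<le> t powr 0" using r t by (intro powr_mono) auto
      then have "C1 * t powr ((r - 1) / 2) \<le> C1"
        using t \<alpha> \<delta> by (intro mult_left_le) (auto simp: C1_def)
      finally show ?thesis .
    qed
    moreover have "norm ((\<delta> * t * P t) *\<^sub>R v t) \<le> norm (V t) + norm (P t *\<^sub>R z t)"
      using norm_triangle_ineq4[of "V t" "P t *\<^sub>R z t"] by (simp add: V_def)
    ultimately have "\<delta> * t powr (\<tau> / 2) * norm (v t) \<le> sqrt (2 * B\<^sup>2) + C1"
      using \<delta> t unfolding d by (simp add: abs_mult)
    then show ?thesis using \<delta> t by (simp add: C2_def field_simps powr_minus)
  qed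
  define C where "C = max C1 C2 + B\<^sup>2 / (\<mu> * \<delta>\<^sup>2)"
  have nonneg: "C1 \<ge> 0" "C2 \<ge> 0" "B\<^sup>2 / (\<mu> * \<delta>\<^sup>2) \<ge> 0"
    using \<alpha> \<delta> \<mu> by (auto simp: C1_def C2_def)
  show thesis
  proof (rule that[of T C])
    fix t assume t: "t \<ge> T"
    have "\<mu> * \<delta>\<^sup>2 * (t powr (1 / \<delta>) * \<phi> t) \<le> B\<^sup>2"
      using E_le[OF t] parts_nonneg(2)[OF t] inner_ge_zero[of "V t"] unfolding E_def by linarith
    then have "t powr (1 / \<delta>) * \<phi> t \<le> B\<^sup>2 / (\<mu> * \<delta>\<^sup>2)" using \<mu> \<delta> by (simp add: field_simps)
    then show "t powr (1 / \<delta>) * \<phi> t \<le> C" using nonneg by (simp add: C_def)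
    have "C1 \<le> C" "C2 \<le> C" using nonneg by (auto simp: C_def)
    then show "norm (z t) \<le> C * t powr ((1 + r - \<tau>) / 2)" "norm (v t) \<le> C * t powr (- \<tau> / 2)"
      using z_le[OF t] v_le[OF t] by (meson mult_right_mono order_trans powr_ge_zero)+
  qed (use T nonneg in \<open>auto simp: C_def\<close>)
qed

section \<open>Decay of the constraint residual from the dual equation\<close>

text \<open>The growth allowed for \<open>y\<close> is harmless: after integration by parts the
  remainder has exponents \<tau>/2 - 2 and (\<tau> - 3 - r)/2. Both are below -1, as \<tau> < 1 + r
  < 2, so the remainder is integrable at infinity.\<close>

lemma residual_bound:
  fixes q q' y v :: "real \<Rightarrow> 'b::real_inner"
  assumes T: "T > 0" and \<alpha>: "\<alpha> > 0" and \<delta>: "\<delta> > 0" and \<mu>: "\<mu> > 0"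
    and r: "r < 1" and \<tau>: "\<tau> < r + 1"
    and q: "\<And>t. t \<ge> T \<Longrightarrow> (q has_vector_derivative q' t) (at t)"
    and y: "\<And>t. t \<ge> T \<Longrightarrow> (y has_vector_derivative v t) (at t)"
    and v: "\<And>t. t \<ge> T \<Longrightarrow> (v has_vector_derivative
      (\<mu> * t powr (1 / \<delta> - \<tau>)) *\<^sub>R (q t + (\<delta> * t) *\<^sub>R q' t) - (\<alpha> / t powr r) *\<^sub>R v t) (at t)"
    and C: "C \<ge> 0"
    and y_le: "\<And>t. t \<ge> T \<Longrightarrow> norm (y t) \<le> C * t powr ((1 + r - \<tau>) / 2)"
    and v_le: "\<And>t. t \<ge> T \<Longrightarrow> norm (v t) \<le> C * t powr (- \<tau> / 2)"
  obtains M where "\<And>t. t \<ge> T \<Longrightarrow> t powr (1 / \<delta>) * norm (q t) \<le> M"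
proof -
  \<comment> \<open>\<open>U\<close> is the boundary term of the integration by parts.\<close>
  define U where "U t = t powr (\<tau> - 1) *\<^sub>R v t + (\<alpha> * t powr (\<tau> - 1 - r)) *\<^sub>R y t" for t
  define R where "R t = (\<mu> * \<delta> * t powr (1 / \<delta>)) *\<^sub>R q t - U t" for t
  define R' where "R' t = - (((\<tau> - 1) * t powr (\<tau> - 2)) *\<^sub>R v t
    + (\<alpha> * (\<tau> - 1 - r) * t powr (\<tau> - 2 - r)) *\<^sub>R y t)" for t
  \<comment> \<open>The primitive of the majorant \<open>\<psi>'\<close> of
    \<open>norm (R' t)\<close> that tends to 0 at infinity. It is nonpositive, so -\<psi>(T) bounds
    the variation of \<open>R\<close> after \<open>T\<close>.\<close>
  define \<psi> where "\<psi> t = - C * (\<bar>\<tau> - 1\<bar> / (1 - \<tau> / 2) * t powr (\<tau> / 2 - 1)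
    + 2 * \<alpha> * t powr ((\<tau> - 1 - r) / 2))" for t
  define \<psi>' where "\<psi>' t = C * (\<bar>\<tau> - 1\<bar> * t powr (\<tau> / 2 - 2)
    + \<alpha> * (1 + r - \<tau>) * t powr ((\<tau> - 3 - r) / 2))" for t
  have R_deriv: "(R has_vector_derivative R' t) (at t)" if "t \<ge> T" for t
  proof -
    have t: "t > 0" using that T by simp
    have p: "((\<lambda>t. c * t powr p) has_real_derivative c * (p * t powr (p - 1))) (at t)" for c p
      using t by (intro DERIV_cmult has_real_derivative_powr)
    have Q: "t powr (1 / \<delta> - 1) = t powr (\<tau> - 1) * t powr (1 / \<delta> - \<tau>)"
      "t powr (\<tau> - 1) / t powr r = t powr (\<tau> - 1 - r)"
      "t * t powr (1 / \<delta> - 1) = t powr (1 / \<delta>)"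
      using t by (simp add: powr_add[symmetric]) (use t in \<open>simp_all add: powr_diff\<close>)
    have R: "(R has_vector_derivative
      ((\<mu> * \<delta> * t powr (1 / \<delta>)) *\<^sub>R q' t + (\<mu> * \<delta> * (1 / \<delta> * t powr (1 / \<delta> - 1))) *\<^sub>R q t)
      - ((t powr (\<tau> - 1) *\<^sub>R ((\<mu> * t powr (1 / \<delta> - \<tau>)) *\<^sub>R (q t + (\<delta> * t) *\<^sub>R q' t) - (\<alpha> / t powr r) *\<^sub>R v t)
         + ((\<tau> - 1) * t powr (\<tau> - 1 - 1)) *\<^sub>R v t)
       + ((\<alpha> * t powr (\<tau> - 1 - r)) *\<^sub>R v t
         + (\<alpha> * ((\<tau> - 1 - r) * t powr (\<tau> - 1 - r - 1))) *\<^sub>R y t))) (at t)"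
      unfolding R_def U_def using that t
      by (intro has_vector_derivative_diff has_vector_derivative_add has_vector_derivative_scaleR
          p has_real_derivative_powr q y v)
    \<comment> \<open>Multiplied by t^(\<tau> - 1), the driving term of \<open>v'\<close> is exactly
      the derivative of \<mu> \<delta> t^(1/\<delta>) q, and the damping cancels the \<alpha> term
      coming from y' = v. Only derivatives of the weights in \<open>U\<close> survive in
      \<open>R'\<close>.\<close>
    have eq: "t powr (\<tau> - 1) *\<^sub>R ((\<mu> * t powr (1 / \<delta> - \<tau>)) *\<^sub>R (q t + (\<delta> * t) *\<^sub>R q' t)
        - (\<alpha> / t powr r) *\<^sub>R v t)
      = (\<mu> * t powr (1 / \<delta> - 1)) *\<^sub>R q t + (\<mu> * \<delta> * t powr (1 / \<delta>)) *\<^sub>R q' t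
        - (\<alpha> * t powr (\<tau> - 1 - r)) *\<^sub>R v t"
      unfolding Q(2)[symmetric] Q(3)[symmetric] unfolding Q(1)
      by (simp add: algebra_simps)
    show ?thesis using R[unfolded eq] \<delta> by (simp add: R'_def algebra_simps)
  qed
  have \<psi>_deriv: "(\<psi> has_vector_derivative \<psi>' t) (at t)" if "t \<ge> T" for t
  proof -
    have "t > 0" "1 - \<tau> / 2 \<noteq> 0" using that T r \<tau> by auto
    then have \<psi>: "(\<psi> has_real_derivative - C * (\<bar>\<tau> - 1\<bar> / (1 - \<tau> / 2) * ((\<tau> / 2 - 1) * t powr (\<tau> / 2 - 1 - 1))
      + 2 * \<alpha> * ((\<tau> - 1 - r) / 2 * t powr ((\<tau> - 1 - r) / 2 - 1)))) (at t)"
      unfolding \<psi>_def by (intro DERIV_cmult DERIV_add has_real_derivative_powr)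
    have eq1: "\<bar>\<tau> - 1\<bar> / (1 - \<tau> / 2) * ((\<tau> / 2 - 1) * c) = - (\<bar>\<tau> - 1\<bar> * c)" for c
      using \<open>1 - \<tau> / 2 \<noteq> 0\<close> by (simp add: field_simps)
    have eq2: "(\<tau> - 1 - r) / 2 - 1 = (\<tau> - 3 - r) / 2" by (simp add: field_simps)
    have eq3: "2 * \<alpha> * ((\<tau> - 1 - r) / 2 * c) = \<alpha> * (\<tau> - 1 - r) * c" for c by simp
    show ?thesis using \<psi>[unfolded eq1 eq2 eq3]
      by (simp add: \<psi>'_def has_real_derivative_iff_has_vector_derivative algebra_simps)
  qed
  have R'_le: "norm (R' t) \<le> \<psi>' t" if "t \<ge> T" for t
  proof -
    have abs_eq: "\<bar>\<tau> - 1 - r\<bar> = 1 + r - \<tau>" using \<tau> by simp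
    have "norm (R' t) \<le> \<bar>\<tau> - 1\<bar> * t powr (\<tau> - 2) * norm (v t)
       + \<alpha> * (1 + r - \<tau>) * t powr (\<tau> - 2 - r) * norm (y t)"
      unfolding R'_def norm_minus_cancel
      by (rule norm_triangle_le) (use \<alpha> in \<open>simp add: abs_mult abs_eq\<close>)
    also have "\<dots> \<le> \<bar>\<tau> - 1\<bar> * t powr (\<tau> - 2) * (C * t powr (- \<tau> / 2))
       + \<alpha> * (1 + r - \<tau>) * t powr (\<tau> - 2 - r) * (C * t powr ((1 + r - \<tau>) / 2))"
      using \<alpha> \<tau> by (intro add_mono mult_left_mono v_le y_le that) auto
    also have "\<dots> = C * (\<bar>\<tau> - 1\<bar> * (t powr (\<tau> - 2) * t powr (- \<tau> / 2))
       + \<alpha> * (1 + r - \<tau>) * (t powr (\<tau> - 2 - r) * t powr ((1 + r - \<tau>) / 2)))"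
      by (simp add: algebra_simps)
    also have "\<dots> = \<psi>' t"
    proof -
      have "\<tau> - 2 + - \<tau> / 2 = \<tau> / 2 - 2" "\<tau> - 2 - r + (1 + r - \<tau>) / 2 = (\<tau> - 3 - r) / 2"
        by (auto simp: field_simps)
      then show ?thesis unfolding \<psi>'_def powr_add[symmetric] by (simp only:)
    qed
    finally show ?thesis .
  qed
  have \<psi>_le: "\<psi> t \<le> 0" for t
    unfolding \<psi>_def using C \<alpha> r \<tau> by (auto intro!: mult_nonneg_nonneg add_nonneg_nonneg divide_nonneg_nonneg)
  have R_le: "norm (R t) \<le> norm (R T) - \<psi> T" if "t \<ge> T" for t
  proof (cases "t = T")
    case True then show ?thesis using \<psi>_le[of T] by simp
  next
    case False
    have "norm (R t - R T) \<le> \<psi> t - \<psi> T"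
      using False that
      by (intro differentiable_bound_general[where f' = R' and \<phi>' = \<psi>'])
        (auto intro!: continuous_at_imp_continuous_on has_vector_derivative_continuous[OF R_deriv]
          has_vector_derivative_continuous[OF \<psi>_deriv] R_deriv \<psi>_deriv R'_le)
    then show ?thesis using norm_triangle_sub[of "R t" "R T"] \<psi>_le[of t] by simp
  qed
  \<comment> \<open>After inserting the bounds, both exponents are negative, so the values at
    \<open>T\<close> dominate.\<close>
  have U_le: "norm (U t) \<le> C * T powr (\<tau> / 2 - 1) + \<alpha> * C * T powr ((\<tau> - 1 - r) / 2)" if "t \<ge> T" for t
  proof -
    have "norm (U t) \<le> t powr (\<tau> - 1) * norm (v t) + \<alpha> * t powr (\<tau> - 1 - r) * norm (y t)"
      unfolding U_def by (rule norm_triangle_le) (use \<alpha> in \<open>simp add: abs_mult\<close>)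
    also have "\<dots> \<le> t powr (\<tau> - 1) * (C * t powr (- \<tau> / 2))
        + \<alpha> * t powr (\<tau> - 1 - r) * (C * t powr ((1 + r - \<tau>) / 2))"
      using \<alpha> by (intro add_mono mult_left_mono v_le y_le that) auto
    also have "\<dots> = C * (t powr (\<tau> - 1) * t powr (- \<tau> / 2))
        + \<alpha> * C * (t powr (\<tau> - 1 - r) * t powr ((1 + r - \<tau>) / 2))"
      by (simp add: algebra_simps)
    also have "\<dots> = C * t powr (\<tau> / 2 - 1) + \<alpha> * C * t powr ((\<tau> - 1 - r) / 2)"
    proof -
      have "\<tau> - 1 + - \<tau> / 2 = \<tau> / 2 - 1" "\<tau> - 1 - r + (1 + r - \<tau>) / 2 = (\<tau> - 1 - r) / 2"
        by (auto simp: field_simps)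
      then show ?thesis unfolding powr_add[symmetric] by (simp only:)
    qed
    also have "\<dots> \<le> C * T powr (\<tau> / 2 - 1) + \<alpha> * C * T powr ((\<tau> - 1 - r) / 2)"
      using C \<alpha> T that r \<tau> by (intro add_mono mult_left_mono powr_mono2') auto
    finally show ?thesis .
  qed
  show thesis
  proof (rule that)
    fix t assume t: "t \<ge> T"
    have "\<mu> * \<delta> * (t powr (1 / \<delta>) * norm (q t)) = norm (R t + U t)"
      using \<mu> \<delta> by (simp add: R_def abs_mult)
    also have "\<dots> \<le> norm (R t) + norm (U t)" by (rule norm_triangle_ineq)
    also have "\<dots> \<le> norm (R T) - \<psi> T + (C * T powr (\<tau> / 2 - 1) + \<alpha> * C * T powr ((\<tau> - 1 - r) / 2))"
      by (intro add_mono R_le U_le t)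
    finally show "t powr (1 / \<delta>) * norm (q t) \<le>
        (norm (R T) - \<psi> T + (C * T powr (\<tau> / 2 - 1) + \<alpha> * C * T powr ((\<tau> - 1 - r) / 2))) / (\<mu> * \<delta>)"
      using \<mu> \<delta> by (simp add: pos_le_divide_eq mult.commute)
  qed
qed

section \<open>From almost-everywhere equations to pointwise ones; saddle points; derivatives on the
  ray\<close>

text \<open>The points after \<open>t0\<close> where two continuous functions differ form an open
  set; being null, it is empty. Leaving out the endpoint makes the set open in the whole
  line.\<close>

lemma eq_on_ray_if_AE_eq:
  fixes g h :: "real \<Rightarrow> 'a::real_normed_vector"
  assumes ae: "AE s\<in>{t0..} in lebesgue. g s = h s"
    and cont: "continuous_on {t0..} g" "continuous_on {t0..} h" and t: "t > t0"
  shows "g t = h t"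
proof (rule ccontr)
  assume "g t \<noteq> h t"
  define D where "D = {s \<in> {t0<..}. g s - h s \<in> - {0}}"
  obtain N where N: "N \<in> null_sets lebesgue" "\<And>s. s \<ge> t0 \<Longrightarrow> g s \<noteq> h s \<Longrightarrow> s \<in> N"
    using ae by (elim AE_E3) (auto simp: subset_eq)
  have "D \<subseteq> N" using N(2) by (auto simp: D_def)
  then have "negligible D" using N(1) negligible_subset negligible_iff_null_sets by blast
  moreover have "open D"
  proof -
    have "continuous_on {t0<..} (\<lambda>s. g s - h s)"
      by (intro continuous_on_diff) (use cont in \<open>auto intro: continuous_on_subset\<close>)
    then have "open ({t0<..} \<inter> (\<lambda>s. g s - h s) -` (- {0}))"
      by (rule continuous_open_preimage) auto
    moreover have "D = {t0<..} \<inter> (\<lambda>s. g s - h s) -` (- {0})" by (auto simp: D_def)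
    ultimately show ?thesis by simp
  qed
  moreover have "t \<in> D" using t \<open>g t \<noteq> h t\<close> by (simp add: D_def)
  ultimately show False using open_not_negligible by blast
qed

text \<open>Shifting the multiplier by the residual itself raises the Lagrangian by the squared norm
  of the residual.\<close>

lemma saddle_points_feasible:
  assumes "(xs, ls) \<in> saddle_points f A b"
  shows "A xs = b"
proof -
  have "lagrangian f A b xs (ls + (A xs - b)) \<le> lagrangian f A b xs ls"
    using assms by (auto simp: saddle_points_def)
  then have "(A xs - b) \<bullet> (A xs - b) \<le> 0" by (simp add: lagrangian_def inner_add_left)
  then show ?thesis by (metis inner_eq_zero_iff inner_ge_zero order_antisym right_minus_eq)
qed

lemma saddle_points_le:
  assumes "(xs, ls) \<in> saddle_points f A b"
  shows "f xs \<le> f u + ls \<bullet> (A u - b)"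
proof -
  have "lagrangian f A b xs ls \<le> lagrangian f A b u ls"
    using assms by (auto simp: saddle_points_def)
  then show ?thesis using saddle_points_feasible[OF assms] by (simp add: lagrangian_def)
qed

lemma C2_on_ray_derivs:
  assumes "C2_on_ray t0 x" and "t > t0"
  shows "(x has_vector_derivative ray_deriv t0 x t) (at t)"
    and "(ray_deriv t0 x has_vector_derivative ray_deriv t0 (ray_deriv t0 x) t) (at t)"
proof -
  have "at t within {t0..} = at t" using assms(2) by (intro at_within_interior) simp
  then show "(x has_vector_derivative ray_deriv t0 x t) (at t)"
    "(ray_deriv t0 x has_vector_derivative ray_deriv t0 (ray_deriv t0 x) t) (at t)"
    using assms unfolding C2_on_ray_def by (metis less_imp_le)+
qed

lemma C2_on_ray_continuous:
  assumes "C2_on_ray t0 x"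
  shows "continuous_on {t0..} x" "continuous_on {t0..} (ray_deriv t0 x)"
    "continuous_on {t0..} (ray_deriv t0 (ray_deriv t0 x))"
  using assms unfolding C2_on_ray_def
  by (auto simp: continuous_on_eq_continuous_within intro: has_vector_derivative_continuous)

section \<open>Convergence rates along the trajectory\<close>

theorem theorem2p7:
  fixes f :: "'a::{real_inner, complete_space} \<Rightarrow> real"
    and gradf :: "'a \<Rightarrow> 'a"
    and A :: "'a \<Rightarrow> 'b::{real_inner, complete_space}"
    and b :: 'b
    and t0 \<alpha> \<delta> \<sigma> \<mu> r \<tau> :: real
    and \<beta> :: "real \<Rightarrow> real"
    and \<epsilon> :: "real \<Rightarrow> 'a"
    and x :: "real \<Rightarrow> 'a"
    and l :: "real \<Rightarrow> 'b"
    and xs :: 'a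
    and ls :: 'b
  assumes A: "bounded_linear A"
    and f_convex: "convex_on UNIV f"
    and f_grad: "\<And>y. GDERIV f y :> gradf y"
    and f_C1: "continuous_on UNIV gradf"
    and t0: "t0 > 0"
    and \<alpha>: "\<alpha> > 0"
    and \<delta>: "\<delta> > 0"
    and \<sigma>: "\<sigma> \<ge> 0"
    and \<mu>: "\<mu> > 0"
    and r: "r \<in> {0<..<1}"
    and \<tau>: "\<tau> \<in> {0<..<r + 1}"
    and \<delta>\<tau>: "\<delta> * \<tau> \<le> 1"
    and \<beta>: "\<And>t. t \<ge> t0 \<Longrightarrow> \<beta> t = \<mu> * t powr (1 / \<delta> - \<tau>)"
    and \<epsilon>: "set_integrable lebesgue {t0..} (\<lambda>t. t powr (\<tau> / 2) * norm (\<epsilon> t))"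
    and x_C2: "C2_on_ray t0 x"
    and l_C2: "C2_on_ray t0 l"
    and AC: "locally_absolutely_continuous_on_ray t0 (\<lambda>t. (x t, l t))"
    and AC_deriv: "locally_absolutely_continuous_on_ray t0 (\<lambda>t. (ray_deriv t0 x t, ray_deriv t0 l t))"
    and system: "AE t\<in>{t0..} in lebesgue.
        ray_deriv t0 (ray_deriv t0 x) t + (\<alpha> / t powr r) *\<^sub>R ray_deriv t0 x t
          = - (\<beta> t *\<^sub>R (gradf (x t)
                + adjoint A (l t + (\<delta> * t) *\<^sub>R ray_deriv t0 l t)
                + \<sigma> *\<^sub>R adjoint A (A (x t) - b)))
            + \<epsilon> t \<and>
        ray_deriv t0 (ray_deriv t0 l) t + (\<alpha> / t powr r) *\<^sub>R ray_deriv t0 l t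
          = \<beta> t *\<^sub>R (A (x t + (\<delta> * t) *\<^sub>R ray_deriv t0 x t) - b)"
    and saddle: "(xs, ls) \<in> saddle_points f A b"
  shows "(\<lambda>t. \<bar>f (x t) - f xs\<bar>) \<in> O(\<lambda>t. 1 / t powr (1 / \<delta>)) \<and>
         (\<lambda>t. norm (A (x t) - b)) \<in> O(\<lambda>t. 1 / t powr (1 / \<delta>))"
proof -
  interpret A: bounded_linear A by (rule A)
  interpret At: bounded_linear "adjoint A" by (rule bounded_linear_adjoint[OF A])
  have feas: "A xs = b" by (rule saddle_points_feasible[OF saddle])
  have r1: "r < 1" and \<tau>1: "\<tau> < r + 1" using r \<tau> by auto
  let ?x' = "ray_deriv t0 x" and ?l' = "ray_deriv t0 l"
  let ?x'' = "ray_deriv t0 ?x'" and ?l'' = "ray_deriv t0 ?l'"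
  note cont_x [continuous_intros] = C2_on_ray_continuous[OF x_C2]
  note cont_l [continuous_intros] = C2_on_ray_continuous[OF l_C2]
  define q where "q t = A (x t) - b" for t
  define p where "p t = A (x t + (\<delta> * t) *\<^sub>R ?x' t) - b" for t
  define G where "G t = gradf (x t) + adjoint A (l t + (\<delta> * t) *\<^sub>R ?l' t) + \<sigma> *\<^sub>R adjoint A (q t)" for t
  have p_eq: "p t = q t + (\<delta> * t) *\<^sub>R A (?x' t)" for t
    by (simp add: p_def q_def A.add A.scaleR)
  have \<beta>_cont: "continuous_on {t0..} \<beta>"
  proof -
    have "continuous_on {t0..} (\<lambda>t. \<mu> * t powr (1 / \<delta> - \<tau>))"
      using t0 by (intro continuous_intros) auto
    then show ?thesis by (subst continuous_on_cong[OF refl \<beta>]) auto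
  qed
  have gradf_cont: "continuous_on {t0..} (\<lambda>t. gradf (x t))"
    by (rule continuous_on_compose2[OF f_C1 cont_x(1)]) simp
  have p_cont: "continuous_on {t0..} p" and G_cont: "continuous_on {t0..} G"
    unfolding p_def G_def q_def
    by (intro continuous_intros A.continuous_on At.continuous_on gradf_cont)+
  have damp_cont: "continuous_on {t0..} (\<lambda>t. \<alpha> / t powr r)"
    using t0 by (intro continuous_intros) auto
  \<comment> \<open>\<open>w\<close> is the continuous representative of \<open>\<epsilon>\<close>, so that its primitive is differentiable
    everywhere.\<close>
  define w where "w t = ?x'' t + (\<alpha> / t powr r) *\<^sub>R ?x' t + \<beta> t *\<^sub>R G t" for t
  have w_cont: "continuous_on {t0..} w"
    unfolding w_def by (intro continuous_intros damp_cont \<beta>_cont G_cont)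
  have w_int: "(\<lambda>t. t powr (\<tau> / 2) * norm (w t)) integrable_on {t0..}"
  proof -
    \<comment> \<open>This is the first equation of the system solved for the perturbation; weighted
      integrability ignores the exceptional null set.\<close>
    have "AE t\<in>{t0..} in lebesgue. w t = \<epsilon> t"
      using system by eventually_elim (auto simp: w_def G_def q_def)
    then obtain N where N: "N \<in> null_sets lebesgue" "\<And>t. t \<ge> t0 \<Longrightarrow> w t \<noteq> \<epsilon> t \<Longrightarrow> t \<in> N"
      by (elim AE_E3) (auto simp: subset_eq)
    have "(\<lambda>t. t powr (\<tau> / 2) * norm (w t)) absolutely_integrable_on {t0..}"
    proof (rule absolutely_integrable_spike[OF \<epsilon>])
      show "negligible N" using N(1) by (simp add: negligible_iff_null_sets)
      show "t powr (\<tau> / 2) * norm (w t) = t powr (\<tau> / 2) * norm (\<epsilon> t)" if "t \<in> {t0..} - N" for t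
      proof -
        have "w t = \<epsilon> t" using N(2)[of t] that by blast
        then show ?thesis by simp
      qed
    qed
    then show ?thesis by (simp add: absolutely_integrable_on_def)
  qed
  have l_eq: "?l'' t + (\<alpha> / t powr r) *\<^sub>R ?l' t = \<beta> t *\<^sub>R p t" if "t > t0" for t
  proof (rule eq_on_ray_if_AE_eq[OF _ _ _ that])
    show "AE t\<in>{t0..} in lebesgue. ?l'' t + (\<alpha> / t powr r) *\<^sub>R ?l' t = \<beta> t *\<^sub>R p t"
      using system by eventually_elim (auto simp: p_def)
    show "continuous_on {t0..} (\<lambda>t. ?l'' t + (\<alpha> / t powr r) *\<^sub>R ?l' t)"
      "continuous_on {t0..} (\<lambda>t. \<beta> t *\<^sub>R p t)"
      by (intro continuous_intros damp_cont \<beta>_cont p_cont)+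
  qed
  have x_deriv: "(x has_vector_derivative ?x' t) (at t)" "(?x' has_vector_derivative ?x'' t) (at t)"
    and l_deriv: "(l has_vector_derivative ?l' t) (at t)" "(?l' has_vector_derivative ?l'' t) (at t)"
    if "t > t0" for t
    using C2_on_ray_derivs[OF x_C2 that] C2_on_ray_derivs[OF l_C2 that] by auto
  have q_deriv: "(q has_vector_derivative A (?x' t)) (at t)" if "t > t0" for t
    unfolding q_def using A.has_vector_derivative[OF x_deriv(1)[OF that]]
    by (auto intro!: derivative_eq_intros)
  \<comment> \<open>The gap of the augmented Lagrangian at the fixed multiplier \<open>ls\<close>;
    \<open>\<phi>'\<close> is its derivative along the trajectory.\<close>
  define \<phi> where "\<phi> t = f (x t) - f xs + ls \<bullet> q t + \<sigma> / 2 * (q t \<bullet> q t)" for t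
  define \<phi>' where "\<phi>' t = gradf (x t) \<bullet> ?x' t + ls \<bullet> A (?x' t) + \<sigma> * (q t \<bullet> A (?x' t))" for t
  have \<phi>_deriv: "(\<phi> has_real_derivative \<phi>' t) (at t)" if "t > t0" for t
  proof -
    have x: "(x has_derivative (\<lambda>s. s *\<^sub>R ?x' t)) (at t)"
      and q: "(q has_derivative (\<lambda>s. s *\<^sub>R A (?x' t))) (at t)"
      using x_deriv(1)[OF that] q_deriv[OF that] by (auto simp: has_vector_derivative_def)
    have "((\<lambda>t. f (x t)) has_derivative (\<lambda>s. (s *\<^sub>R ?x' t) \<bullet> gradf (x t))) (at t)"
      using has_derivative_compose[OF x f_grad[unfolded gderiv_def]] .
    then have "(\<phi> has_derivative (\<lambda>s. s * \<phi>' t)) (at t)"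
      unfolding \<phi>_def \<phi>'_def by (auto intro!: derivative_eq_intros q simp: inner_commute algebra_simps)
    then show ?thesis by (simp add: has_field_derivative_def mult_commute_abs)
  qed
  have \<phi>_nonneg: "\<phi> t \<ge> 0" for t
    using saddle_points_le[OF saddle, of "x t"] \<sigma> by (simp add: \<phi>_def q_def)
  \<comment> \<open>As A (x - xs + \<delta> t x') = p, the pairings of l + \<delta> t l' with
    \<open>p\<close> cancel and only ls . p remains. The tangent inequality at \<open>x t\<close>
    and dropping half of the \<sigma> term then give the bound.\<close>
  have dissipation: "(G t, - p t) \<bullet> ((x t - xs, l t - ls) + (\<delta> * t) *\<^sub>R (?x' t, ?l' t))
      \<ge> \<phi> t + \<delta> * t * \<phi>' t" for t
  proof -
    have adj: "adjoint A u \<bullet> v = u \<bullet> A v" for u v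
      using adjoint_inner[OF A, of v u] by (simp add: inner_commute)
    have Ax: "A (x t - xs) = q t" by (simp add: A.diff feas q_def)
    have "(G t, - p t) \<bullet> ((x t - xs, l t - ls) + (\<delta> * t) *\<^sub>R (?x' t, ?l' t))
      = gradf (x t) \<bullet> (x t - xs) + ls \<bullet> q t + \<sigma> * (q t \<bullet> q t) + \<delta> * t * \<phi>' t"
      unfolding G_def p_eq \<phi>'_def
      by (simp add: inner_add_left adj A.add A.scaleR Ax)
        (simp add: inner_simps inner_commute algebra_simps)
    moreover have "gradf (x t) \<bullet> (x t - xs) \<ge> f (x t) - f xs"
      using convex_on_GDERIV_above_tangent[OF f_convex f_grad, of "x t" xs]
      by (simp add: inner_diff_right)
    moreover have "\<sigma> * (q t \<bullet> q t) \<ge> \<sigma> / 2 * (q t \<bullet> q t)"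
      using \<sigma> by (intro mult_right_mono) auto
    ultimately show ?thesis by (simp add: \<phi>_def)
  qed
  obtain T C where T: "T > t0" and C: "C \<ge> 0"
    and \<phi>_le: "\<And>t. t \<ge> T \<Longrightarrow> t powr (1 / \<delta>) * \<phi> t \<le> C"
    and z_le: "\<And>t. t \<ge> T \<Longrightarrow> norm (x t - xs, l t - ls) \<le> C * t powr ((1 + r - \<tau>) / 2)"
    and v_le: "\<And>t. t \<ge> T \<Longrightarrow> norm (?x' t, ?l' t) \<le> C * t powr (- \<tau> / 2)"
  \<comment> \<open>The second component of \<open>F\<close> is -p because \<open>F\<close> enters
    the abstract equation with a minus sign; the dual equation carries no perturbation.\<close>
  proof (rule energy_bounds[where z = "\<lambda>t. (x t - xs, l t - ls)" and v = "\<lambda>t. (?x' t, ?l' t)"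
        and F = "\<lambda>t. (G t, - p t)" and e = "\<lambda>t. (w t, 0)" and \<phi> = \<phi> and \<phi>' = \<phi>',
        OF t0 \<alpha> \<delta> \<mu> r1 \<tau>1])
    fix t assume t: "t > t0"
    show "((\<lambda>t. (x t - xs, l t - ls)) has_vector_derivative (?x' t, ?l' t)) (at t)"
      using x_deriv[OF t] l_deriv[OF t] by (auto intro!: derivative_eq_intros)
    have "\<mu> * t powr (1 / \<delta> - \<tau>) = \<beta> t" using \<beta> t by simp
    moreover have "?l'' t = \<beta> t *\<^sub>R p t - (\<alpha> / t powr r) *\<^sub>R ?l' t"
      using l_eq[OF t] by (simp add: algebra_simps)
    ultimately have "(w t, 0) - (\<alpha> / t powr r) *\<^sub>R (?x' t, ?l' t)
        - (\<mu> * t powr (1 / \<delta> - \<tau>)) *\<^sub>R (G t, - p t) = (?x'' t, ?l'' t)"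
      by (simp add: w_def)
    then show "((\<lambda>t. (?x' t, ?l' t)) has_vector_derivative (w t, 0)
        - (\<alpha> / t powr r) *\<^sub>R (?x' t, ?l' t) - (\<mu> * t powr (1 / \<delta> - \<tau>)) *\<^sub>R (G t, - p t)) (at t)"
      using x_deriv[OF t] l_deriv[OF t] by (simp add: has_vector_derivative_Pair)
  qed (use \<phi>_deriv \<phi>_nonneg dissipation w_int in \<open>auto intro!: continuous_intros w_cont simp: norm_Pair\<close>)
  obtain M where M: "\<And>t. t \<ge> T \<Longrightarrow> t powr (1 / \<delta>) * norm (q t) \<le> M"
  proof (rule residual_bound[where q = q and q' = "\<lambda>t. A (?x' t)" and y = "\<lambda>t. l t - ls" and v = ?l',
        OF _ \<alpha> \<delta> \<mu> r1 \<tau>1])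
    fix t assume "t \<ge> T"
    then have t: "t > t0" using T by simp
    show "(q has_vector_derivative A (?x' t)) (at t)" by (rule q_deriv[OF t])
    show "((\<lambda>t. l t - ls) has_vector_derivative ?l' t) (at t)"
      using l_deriv[OF t] by (auto intro!: derivative_eq_intros)
    have "(\<mu> * t powr (1 / \<delta> - \<tau>)) *\<^sub>R (q t + (\<delta> * t) *\<^sub>R A (?x' t)) - (\<alpha> / t powr r) *\<^sub>R ?l' t = ?l'' t"
      using l_eq[OF t] \<beta>[of t] t by (simp add: p_eq algebra_simps)
    then show "(?l' has_vector_derivative (\<mu> * t powr (1 / \<delta> - \<tau>)) *\<^sub>R (q t + (\<delta> * t) *\<^sub>R A (?x' t))
        - (\<alpha> / t powr r) *\<^sub>R ?l' t) (at t)" using l_deriv[OF t] by simp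
    show "norm (l t - ls) \<le> C * t powr ((1 + r - \<tau>) / 2)"
      using z_le[OF \<open>t \<ge> T\<close>] norm_snd_le order_trans by blast
    show "norm (?l' t) \<le> C * t powr (- \<tau> / 2)"
      using v_le[OF \<open>t \<ge> T\<close>] norm_snd_le order_trans by blast
  qed (use T t0 C in auto)
  have f_le: "t powr (1 / \<delta>) * \<bar>f (x t) - f xs\<bar> \<le> C + norm ls * M + \<sigma> / 2 * M\<^sup>2"
    if "t \<ge> max T 1" for t
  proof -
    have t: "t \<ge> T" "t \<ge> 1" using that by auto
    define P where "P = t powr (1 / \<delta>)"
    have P: "P \<ge> 1" unfolding P_def using t \<delta> by (simp add: ge_one_powr_ge_zero)
    have Pq: "P * norm (q t) \<le> M" using M[OF t(1)] by (simp add: P_def)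
    have "f (x t) - f xs = \<phi> t - ls \<bullet> q t - \<sigma> / 2 * (norm (q t))\<^sup>2"
      by (simp add: \<phi>_def power2_norm_eq_inner)
    moreover have "\<bar>ls \<bullet> q t\<bar> \<le> norm ls * norm (q t)" by (rule Cauchy_Schwarz_ineq2)
    moreover have "\<sigma> / 2 * (norm (q t))\<^sup>2 \<ge> 0" using \<sigma> by simp
    ultimately have "\<bar>f (x t) - f xs\<bar> \<le> \<phi> t + norm ls * norm (q t) + \<sigma> / 2 * (norm (q t))\<^sup>2"
      using \<phi>_nonneg[of t] by linarith
    then have "P * \<bar>f (x t) - f xs\<bar> \<le> P * (\<phi> t + norm ls * norm (q t) + \<sigma> / 2 * (norm (q t))\<^sup>2)"
      using P by (intro mult_left_mono) auto
    also have "\<dots> = P * \<phi> t + norm ls * (P * norm (q t)) + \<sigma> / 2 * (P * (norm (q t))\<^sup>2)"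
      by (simp add: algebra_simps)
    also have "\<dots> \<le> C + norm ls * M + \<sigma> / 2 * M\<^sup>2"
    proof (intro add_mono mult_left_mono)
      \<comment> \<open>Here t \<ge> 1 matters: it gives P \<ge> 1, so the quadratic term is bounded
        through the square of P |q|.\<close>
      have "P * (norm (q t))\<^sup>2 \<le> P\<^sup>2 * (norm (q t))\<^sup>2"
        using P by (intro mult_right_mono) (auto simp: power2_eq_square)
      also have "\<dots> = (P * norm (q t))\<^sup>2" by (simp add: power_mult_distrib)
      also have "\<dots> \<le> M\<^sup>2" using Pq P by (intro power_mono) auto
      finally show "P * (norm (q t))\<^sup>2 \<le> M\<^sup>2" .
    qed (use \<phi>_le[OF t(1)] Pq \<sigma> in \<open>auto simp: P_def\<close>)
    finally show ?thesis by (simp add: P_def)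
  qed
  have bigo: "g \<in> O(\<lambda>t. 1 / t powr (1 / \<delta>))"
    if "\<And>t. t \<ge> max T 1 \<Longrightarrow> t powr (1 / \<delta>) * \<bar>g t\<bar> \<le> K" for g :: "real \<Rightarrow> real" and K
  proof (rule bigoI[where c = K])
    show "\<forall>\<^sub>F t in at_top. norm (g t) \<le> K * norm (1 / t powr (1 / \<delta>))"
      using eventually_ge_at_top[of "max T 1"]
    proof eventually_elim
      case (elim t)
      then have "t powr (1 / \<delta>) > 0" by simp
      then show ?case using that[OF elim] by (simp add: pos_le_divide_eq mult.commute)
    qed
  qed
  show ?thesis
  proof
    show "(\<lambda>t. \<bar>f (x t) - f xs\<bar>) \<in> O(\<lambda>t. 1 / t powr (1 / \<delta>))"
      by (rule bigo) (use f_le in auto)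
    have "(\<lambda>t. norm (q t)) \<in> O(\<lambda>t. 1 / t powr (1 / \<delta>))"
      by (rule bigo[of _ M]) (use M in auto)
    then show "(\<lambda>t. norm (A (x t) - b)) \<in> O(\<lambda>t. 1 / t powr (1 / \<delta>))"
      by (simp add: q_def)
  qed
qed

end
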